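(* Let $n\ge1$ be an integer and $\alpha\ge n+\frac32$. For any function $f:\mathbb{R}^n\to\mathbb{R}$ with $\|f\|_{\mathrm{Lip}}\le1$ and all $0\le t\le\sqrt{\alpha-n}$, $$\mathfrak{m}_{2n,\alpha}\big\{(x,y)\in\mathbb{R}^n\times\mathbb{R}^n:\ \sqrt{\alpha-n}\,|f(x)-f(y)|\ge t\big\}\le2\,e^{-t^2/12}.$$ In particular, if in addition $\alpha\ge n^2$, then for all $0\le t\le\sqrt{\alpha-n}$, $$(\mathfrak{m}_{n,\alpha}\otimes\mathfrak{m}_{n,\alpha})\big\{(x,y)\in\mathbb{R}^n\times\mathbb{R}^n:\ \sqrt{\alpha-n}\,|f(x)-f(y)|\ge t\big\}\le4\,e^{-t^2/12}.$$
   Context: For an integer $k\ge1$ and a real $\alpha>\frac k2$, the Cauchy measure $\mathfrak{m}_{k,\alpha}$ of order $\alpha$ on $\mathbb{R}^k$ is the probability measure with density $\frac{1}{c_{k,\alpha}}(1+|x|^2)^{-\alpha}$, $x\in\mathbb{R}^k$, with respect to Lebesgue measure, where $c_{k,\alpha}=\pi^{k/2}\,\Gamma(\alpha-\frac k2)/\Gamma(\alpha)$. The measure $\mathfrak{m}_{2n,\alpha}$ is regarded as a measure on $\mathbb{R}^n\times\mathbb{R}^n=\mathbb{R}^{2n}$. $\|f\|_{\mathrm{Lip}}$ is the Lipschitz semi-norm of $f$ with respect to the Euclidean distance. *)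

theory Defs
  imports "HOL-Analysis.Analysis"
begin

definition cauchy_const :: "nat \<Rightarrow> real \<Rightarrow> real" where
  "cauchy_const k \<alpha> = pi powr (real k / 2) * Gamma (\<alpha> - real k / 2) / Gamma \<alpha>"

text \<open>
  The dimension \<open>k\<close> is read off the type. On the product type
  \<open>(real^'n) \<times> (real^'n)\<close> the norm is the Euclidean norm
  \<open>sqrt (\<bar>x\<bar>\<^sup>2 + \<bar>y\<bar>\<^sup>2)\<close>, the dimension is \<open>2 * CARD('n)\<close> and
  \<open>lborel\<close> is the product Lebesgue measure, so that type carries the
  \<open>2n\<close>-dimensional measure. Only the range \<open>\<alpha> > DIM('a) / 2\<close> is meaningful.
\<close>
definition cauchy_measure :: "real \<Rightarrow> 'a::euclidean_space measure" where
  "cauchy_measure \<alpha> = density lborel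
     (\<lambda>x. ennreal (1 / cauchy_const DIM('a) \<alpha> * (1 + (norm x)\<^sup>2) powr (- \<alpha>)))"

definition lip_seminorm :: "('a::metric_space \<Rightarrow> 'b::metric_space) \<Rightarrow> ennreal" where
  "lip_seminorm f = (SUP (x, y)\<in>{(x, y). x \<noteq> y}. ennreal (dist (f x) (f y) / dist x y))"

lemma lip_seminorm_le_iff:
  assumes "0 \<le> L"
  shows "lip_seminorm f \<le> ennreal L \<longleftrightarrow> L-lipschitz_on UNIV f"
proof -
  have "lip_seminorm f \<le> ennreal L \<longleftrightarrow> (\<forall>x y. x \<noteq> y \<longrightarrow> dist (f x) (f y) / dist x y \<le> L)"
    unfolding lip_seminorm_def using assms by (auto simp: SUP_le_iff)
  also have "\<dots> \<longleftrightarrow> (\<forall>x y. dist (f x) (f y) \<le> L * dist x y)"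
    by (metis dist_self divide_le_eq mult_zero_right order_refl zero_less_dist_iff)
  finally show ?thesis
    using assms by (simp add: lipschitz_on_def)
qed

lemma lip_seminorm_le_1_iff: "lip_seminorm f \<le> 1 \<longleftrightarrow> 1-lipschitz_on UNIV f"
  using lip_seminorm_le_iff[of 1 f] by simp

end

theory Submission
  imports Defs "HOL-Probability.Distributions"
begin

text \<open>
  Write \<open>n\<close> for the dimension and \<open>a = \<alpha> - n\<close>. The Cauchy density is a mixture of Gaussian densities:
  \<open>(1 + (norm z)\<^sup>2) powr (- \<alpha>)\<close> is, up to the factor \<open>Gamma \<alpha>\<close>, the integral over \<open>t > 0\<close> of
  \<open>t powr (\<alpha> - 1) * exp (- t) * exp (- t * (norm z)\<^sup>2)\<close>. In dimension \<open>2 * n\<close> the parameter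
  \<open>t\<close>, half the inverse variance, therefore follows a Gamma law with parameter \<open>a\<close>, and for given \<open>t\<close> the two components \<open>x\<close> and
  \<open>y\<close> are independent Gaussian vectors with density proportional to \<open>exp (- t * (norm x)\<^sup>2)\<close>.

  For these Gaussian vectors a 1-Lipschitz \<open>f\<close> satisfies \<open>P (\<bar>f x - f y\<bar> \<ge> r) \<le> 2 * exp (- t * r\<^sup>2 / 2)\<close>
  in every dimension. This follows from the Prekopa--Leindler inequality
  (\<open>prekopa_leindler_midpoint\<close>), which bounds the product of the Laplace transforms of \<open>f\<close> and \<open>- f\<close>
  (\<open>gaussian_exponential_moments_lipschitz\<close>), and Chernoff's bound. Averaging over \<open>t\<close> gives the
  Laplace transform of the Gamma law (\<open>cauchy_measure_le_of_gaussian_bound\<close>): under the Cauchy measure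
  the probability is at most \<open>2 * (1 + r\<^sup>2 / 2) powr (- a)\<close>. With \<open>r = t / sqrt a \<le> 1\<close>, where \<open>t\<close> is
  now the deviation, this is at most \<open>2 * exp (- t\<^sup>2 / 3)\<close> (\<open>cauchy_deviation\<close>), more than required.

  For the product of two Cauchy measures, the product density is bounded by the joint one up to
  the ratio of the normalising constants, which log-convexity of the Gamma function bounds by
  \<open>exp 3\<close> when \<open>\<alpha> \<ge> n\<^sup>2\<close> and \<open>\<alpha> \<ge> n + 3 / 2\<close>. The gap between the exponents \<open>t\<^sup>2 / 3\<close> and \<open>t\<^sup>2 / 12\<close> absorbs this
  factor as soon as \<open>t\<^sup>2 \<ge> 12\<close>, and for smaller \<open>t\<close> the asserted bound exceeds 1.
\<close>

section \<open>The Brunn--Minkowski inequality on the line\<close>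

text \<open>
  Cutting \<open>A\<close> off at its own points, rather than at arbitrary reals, is what the argument for
  sumsets needs; it provides an unbounded substitute for the maximum of a compact set.
\<close>

lemma emeasure_eq_SUP_below_points:
  fixes A :: "real set"
  assumes [measurable]: "A \<in> sets borel" and "A \<noteq> {}"
  shows "emeasure lborel A = (SUP a\<in>A. emeasure lborel (A \<inter> {..a}))"
proof (rule antisym)
  show "emeasure lborel A \<le> (SUP a\<in>A. emeasure lborel (A \<inter> {..a}))"
  proof (cases "\<exists>m\<in>A. \<forall>a\<in>A. a \<le> m")
    case True
    then obtain m where m: "m \<in> A" "\<forall>a\<in>A. a \<le> m" by auto
    then have "A \<inter> {..m} = A" by auto
    then show ?thesis using m by (intro SUP_upper2[of m]) auto
  next
    case False
    \<comment> \<open>Without a maximum, a sequence climbing to the supremum (or to infinity) exhausts \<open>A\<close>.\<close>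
    obtain s :: "nat \<Rightarrow> real" where s: "incseq s" "\<And>n. \<exists>a\<in>A. s n \<le> a" "\<And>a. a \<in> A \<Longrightarrow> \<exists>n. a \<le> s n"
    proof (cases "bdd_above A")
      case bdd: True
      define s where "s n = Sup A - inverse (real (Suc n))" for n
      have "incseq s"
        unfolding s_def by (intro incseq_SucI) (simp add: field_simps)
      moreover have "\<exists>a\<in>A. s n \<le> a" for n
      proof -
        have "s n < Sup A" by (simp add: s_def)
        then show ?thesis using less_cSup_iff[OF \<open>A \<noteq> {}\<close> bdd] by (meson less_imp_le)
      qed
      moreover have "\<exists>n. a \<le> s n" if "a \<in> A" for a
      proof -
        have "a < Sup A"
          using False that bdd by (meson cSup_upper le_less_linear less_le order_trans)
        then obtain n where "inverse (real (Suc n)) < Sup A - a"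
          using reals_Archimedean[of "Sup A - a"] by auto
        then show ?thesis by (intro exI[of _ n]) (simp add: s_def)
      qed
      ultimately show ?thesis using that by blast
    next
      case False
      have "incseq real" by (simp add: incseq_def)
      moreover have "\<exists>a\<in>A. real n \<le> a" for n
        using False unfolding bdd_above_def by (meson linear)
      moreover have "\<exists>n. a \<le> real n" for a
        by (rule real_arch_simple)
      ultimately show ?thesis using that by blast
    qed
    have "A = (\<Union>n. A \<inter> {..s n})" using s(3) by auto
    then have "emeasure lborel A = emeasure lborel (\<Union>n. A \<inter> {..s n})" by simp
    also have "\<dots> = (SUP n. emeasure lborel (A \<inter> {..s n}))"
      using s(1) by (intro SUP_emeasure_incseq[symmetric]) (auto simp: incseq_def intro: order_trans)
    also have "\<dots> \<le> (SUP a\<in>A. emeasure lborel (A \<inter> {..a}))"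
    proof (rule SUP_mono)
      fix n
      obtain a where "a \<in> A" "s n \<le> a" using s(2) by blast
      then show "\<exists>a\<in>A. emeasure lborel (A \<inter> {..s n}) \<le> emeasure lborel (A \<inter> {..a})"
        by (intro bexI[of _ a] emeasure_mono) auto
    qed
    finally show ?thesis .
  qed
qed (auto intro!: SUP_least emeasure_mono)

lemma emeasure_lborel_uminus_vimage:
  fixes B :: "real set"
  assumes [measurable]: "B \<in> sets borel"
  shows "emeasure lborel (uminus -` B) = emeasure lborel B"
proof -
  have "emeasure lborel B = emeasure (distr lborel borel uminus) B"
    by (simp add: lborel_distr_uminus)
  then show ?thesis by (simp add: emeasure_distr)
qed

lemma emeasure_eq_SUP_above_points:
  fixes B :: "real set"
  assumes [measurable]: "B \<in> sets borel" and "B \<noteq> {}"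
  shows "emeasure lborel B = (SUP b\<in>B. emeasure lborel (B \<inter> {b..}))"
proof -
  let ?C = "uminus -` B"
  have [measurable]: "?C \<in> sets borel"
    using measurable_sets[of uminus borel borel B] by simp
  have C: "?C = uminus ` B" by force
  have "emeasure lborel B = (SUP a\<in>?C. emeasure lborel (?C \<inter> {..a}))"
    using emeasure_eq_SUP_below_points[of ?C] emeasure_lborel_uminus_vimage[OF assms(1)] assms(2) \<open>?C \<in> sets borel\<close>
    by (simp only: C) blast
  also have "\<dots> = (SUP b\<in>B. emeasure lborel (?C \<inter> {..-b}))"
    unfolding C by (simp add: image_image)
  also have "\<dots> = (SUP b\<in>B. emeasure lborel (B \<inter> {b..}))"
  proof (rule SUP_cong[OF refl])
    fix b
    have "?C \<inter> {..-b} = uminus -` (B \<inter> {b..})" by auto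
    then show "emeasure lborel (?C \<inter> {..-b}) = emeasure lborel (B \<inter> {b..})"
      using emeasure_lborel_uminus_vimage[of "B \<inter> {b..}"] by simp
  qed
  finally show ?thesis .
qed

lemma emeasure_lborel_translate_vimage:
  fixes A :: "real set"
  assumes [measurable]: "A \<in> sets borel"
  shows "emeasure lborel ((+) c -` A) = emeasure lborel A"
proof -
  have "emeasure lborel A = emeasure (distr lborel borel ((+) c)) A"
    by (simp add: lborel_distr_plus)
  then show ?thesis by (simp add: emeasure_distr)
qed

text \<open>
  For \<open>a \<in> A\<close> and \<open>b \<in> B\<close> the sumset contains a translate by \<open>b\<close> of the part of \<open>A\<close> left of \<open>a\<close>
  and a translate by \<open>a\<close> of the part of \<open>B\<close> right of \<open>b\<close>. These translates lie on different sides
  of \<open>a + b\<close>, so their measures add up, and the suprema over \<open>a\<close> and \<open>b\<close> recover all of \<open>A\<close> and \<open>B\<close>.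
\<close>

lemma brunn_minkowski_real:
  fixes A B C :: "real set"
  assumes [measurable]: "A \<in> sets borel" "B \<in> sets borel" "C \<in> sets borel"
    and ne: "A \<noteq> {}" "B \<noteq> {}"
    and sub: "\<And>a b. a \<in> A \<Longrightarrow> b \<in> B \<Longrightarrow> a + b \<in> C"
  shows "emeasure lborel A + emeasure lborel B \<le> emeasure lborel C"
proof -
  \<comment> \<open>Dropping the point \<open>a\<close> makes the two translates disjoint.\<close>
  have *: "emeasure lborel (A \<inter> {..a}) + emeasure lborel (B \<inter> {b..}) \<le> emeasure lborel C"
    if "a \<in> A" "b \<in> B" for a b
  proof -
    let ?A = "(+) (- b) -` (A \<inter> {..<a})" and ?B = "(+) (- a) -` (B \<inter> {b..})"
    have [measurable]: "?A \<in> sets borel" "?B \<in> sets borel"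
      using measurable_sets[of "(+) (-b)" borel borel "A \<inter> {..<a}"]
        measurable_sets[of "(+) (-a)" borel borel "B \<inter> {b..}"] by simp_all
    have "emeasure lborel (A \<inter> {..a}) = emeasure lborel (A \<inter> {..<a})"
      using AE_lborel_singleton[of a] by (intro emeasure_eq_AE) auto
    then have "emeasure lborel (A \<inter> {..a}) + emeasure lborel (B \<inter> {b..}) = emeasure lborel ?A + emeasure lborel ?B"
      by (simp only: emeasure_lborel_translate_vimage sets.Int assms(1,2) borel_open borel_closed open_lessThan closed_atLeast)
    also have "\<dots> = emeasure lborel (?A \<union> ?B)"
      by (intro plus_emeasure) auto
    also have "\<dots> \<le> emeasure lborel C"
      using that sub[of _ b] sub[of a] by (intro emeasure_mono) force+
    finally show ?thesis .
  qed
  have "emeasure lborel A + emeasure lborel (B \<inter> {b..}) \<le> emeasure lborel C" if "b \<in> B" for b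
    unfolding emeasure_eq_SUP_below_points[OF assms(1) ne(1)]
    using * that ne by (subst ennreal_SUP_add_left[symmetric]) (auto intro: SUP_least)
  then show ?thesis
    unfolding emeasure_eq_SUP_above_points[OF assms(2) ne(2)]
    using ne by (subst ennreal_SUP_add_right) (auto intro: SUP_least)
qed

lemma brunn_minkowski_midpoint_real:
  fixes A B C :: "real set"
  assumes [measurable]: "A \<in> sets borel" "B \<in> sets borel" "C \<in> sets borel"
    and ne: "A \<noteq> {}" "B \<noteq> {}"
    and sub: "\<And>a b. a \<in> A \<Longrightarrow> b \<in> B \<Longrightarrow> (a + b) / 2 \<in> C"
  shows "emeasure lborel A + emeasure lborel B \<le> 2 * emeasure lborel C"
proof -
  let ?D = "(*) (1/2) -` C"
  have [measurable]: "?D \<in> sets borel"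
    using measurable_sets[of "(*) (1/2)" borel borel C] by simp
  have "emeasure lborel A + emeasure lborel B \<le> emeasure lborel ?D"
    using sub ne by (intro brunn_minkowski_real) auto
  also have "\<dots> = emeasure (distr lborel borel ((*) (1/2))) C"
    by (simp add: emeasure_distr)
  also have "\<dots> = 2 * emeasure lborel C"
    by (subst lborel_distr_mult) (simp_all add: emeasure_density nn_integral_cmult)
  finally show ?thesis .
qed

section \<open>The Prekopa--Leindler inequality at midpoints\<close>

lemma emeasure_scaled_subgraph:
  fixes y :: ennreal
  assumes "0 < U"
  shows "emeasure lborel {s\<in>{0<..<1}. ennreal (U * s) < y} = min (y / ennreal U) 1"
proof (cases y)
  case (real r)
  have "{s\<in>{0<..<1}. ennreal (U * s) < y} = {0<..<min 1 (r / U)}"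
    using assms real by (auto simp: ennreal_less_iff field_simps)
  then show ?thesis
    using assms real by (simp add: divide_ennreal min_def flip: ennreal_1)
next
  case top
  then have "{s\<in>{0<..<1}. ennreal (U * s) < y} = {0<..<1}" by auto
  then show ?thesis using top assms by (simp add: ennreal_top_divide flip: ennreal_1)
qed

text \<open>
  Fubini on the region below the graph of \<open>u\<close>. Rescaling the levels by \<open>U\<close> lets functions with
  different suprema be compared over the same interval of levels.
\<close>

lemma layer_cake_truncated:
  fixes u :: "real \<Rightarrow> ennreal"
  assumes [measurable]: "u \<in> borel_measurable borel" and "0 < U"
  shows "(\<integral>\<^sup>+s. emeasure lborel {x. ennreal (U * s) < u x} * indicator {0<..<1} s \<partial>lborel)
     = (\<integral>\<^sup>+x. min (u x / ennreal U) 1 \<partial>lborel)"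
proof -
  have "(\<integral>\<^sup>+s. emeasure lborel {x. ennreal (U * s) < u x} * indicator {0<..<1} s \<partial>lborel)
      = (\<integral>\<^sup>+s. \<integral>\<^sup>+x. indicator {(s, x). s \<in> {0<..<1} \<and> ennreal (U * s) < u x} (s, x) \<partial>lborel \<partial>lborel)"
  proof (rule nn_integral_cong)
    fix s :: real
    have "emeasure lborel {x. ennreal (U * s) < u x} * indicator {0<..<1} s
        = (\<integral>\<^sup>+x. indicator {x. ennreal (U * s) < u x} x * indicator {0<..<1} s \<partial>lborel)"
      by (simp add: nn_integral_multc)
    also have "\<dots> = (\<integral>\<^sup>+x. indicator {(s, x). s \<in> {0<..<1} \<and> ennreal (U * s) < u x} (s, x) \<partial>lborel)"
      by (intro nn_integral_cong) (auto simp: indicator_def)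
    finally show "emeasure lborel {x. ennreal (U * s) < u x} * indicator {0<..<1} s = \<dots>" .
  qed
  also have "\<dots> = (\<integral>\<^sup>+x. \<integral>\<^sup>+s. indicator {(s, x). s \<in> {0<..<1} \<and> ennreal (U * s) < u x} (s, x) \<partial>lborel \<partial>lborel)"
    by (intro lborel_pair.Fubini') measurable
  also have "\<dots> = (\<integral>\<^sup>+x. emeasure lborel {s\<in>{0<..<1}. ennreal (U * s) < u x} \<partial>lborel)"
  proof (rule nn_integral_cong)
    fix x
    have [measurable]: "{s\<in>{0<..<1}. ennreal (U * s) < u x} \<in> sets borel" by measurable
    show "(\<integral>\<^sup>+s. indicator {(s, x). s \<in> {0<..<1} \<and> ennreal (U * s) < u x} (s, x) \<partial>lborel)
        = emeasure lborel {s\<in>{0<..<1}. ennreal (U * s) < u x}"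
      by (subst nn_integral_indicator[symmetric], measurable)
         (intro nn_integral_cong, simp add: indicator_def)
  qed
  finally show ?thesis using emeasure_scaled_subgraph[OF assms(2)] by simp
qed

lemma ennreal_mult_le_square_mean:
  fixes p q r :: ennreal
  assumes "p + q \<le> 2 * r"
  shows "p * q \<le> r\<^sup>2"
proof (cases "r = top")
  case True
  then show ?thesis by (simp add: power2_eq_square ennreal_mult_top)
next
  case False
  then obtain r' where r': "r = ennreal r'" "0 \<le> r'" by (cases r) auto
  have "2 * r < top" by (simp add: r' ennreal_mult_less_top)
  then have "p + q < top" using assms by (rule le_less_trans[rotated])
  then obtain p' q' where pq: "p = ennreal p'" "0 \<le> p'" "q = ennreal q'" "0 \<le> q'"
    by (cases p; cases q) auto
  have le: "p' + q' \<le> 2 * r'"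
    using assms pq r' by (simp add: ennreal_mult[symmetric] flip: ennreal_plus ennreal_numeral)
  have "4 * (p' * q') \<le> (p' + q')\<^sup>2"
    using zero_le_power2[of "p' - q'"] by (simp add: power2_eq_square algebra_simps)
  also have "\<dots> \<le> (2 * r')\<^sup>2" using le pq by (intro power_mono) auto
  finally have "p' * q' \<le> r'\<^sup>2" by (simp add: power_mult_distrib)
  then show ?thesis using pq r' by (simp add: ennreal_power flip: ennreal_mult)
qed

text \<open>
  Levels are measured relative to the suprema \<open>U\<close>, \<open>V\<close> of \<open>u\<close>, \<open>v\<close>, and those of \<open>w\<close> relative to
  \<open>W = sqrt (U * V)\<close>. All relative level sets of \<open>u\<close> and \<open>v\<close> below 1 are then nonempty, the
  hypothesis puts their midpoints into the corresponding level set of \<open>w\<close>, and integrating the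
  Brunn--Minkowski inequality over the levels bounds the arithmetic mean of the two normalised
  integrals. This is stronger than the bound on the geometric mean.
\<close>

lemma prekopa_leindler_midpoint_bounded_real:
  fixes u v w :: "real \<Rightarrow> ennreal"
  assumes [measurable]: "u \<in> borel_measurable borel" "v \<in> borel_measurable borel" "w \<in> borel_measurable borel"
    and le: "\<And>x y. u x * v y \<le> (w ((x + y) / 2))\<^sup>2"
    and bdd: "(SUP x. u x) \<noteq> top" "(SUP x. v x) \<noteq> top"
  shows "integral\<^sup>N lborel u * integral\<^sup>N lborel v \<le> (integral\<^sup>N lborel w)\<^sup>2"
proof (cases "(SUP x. u x) = 0 \<or> (SUP x. v x) = 0")
  case True
  then have "(\<forall>x. u x = 0) \<or> (\<forall>x. v x = 0)"
    by (metis SUP_upper UNIV_I le_zero_eq)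
  then have "integral\<^sup>N lborel u = 0 \<or> integral\<^sup>N lborel v = 0"
    by (auto simp: nn_integral_0_iff_AE)
  then show ?thesis by auto
next
  case False
  obtain U V where U: "(SUP x. u x) = ennreal U" "0 < U" and V: "(SUP x. v x) = ennreal V" "0 < V"
    using False bdd by (cases "SUP x. u x"; cases "SUP x. v x") (auto simp: less_le)
  define W where "W = sqrt (U * V)"
  have W: "0 < W" "W\<^sup>2 = U * V" using U V by (simp_all add: W_def)
  have u_le: "u x \<le> ennreal U" and v_le: "v x \<le> ennreal V" for x
    unfolding U(1)[symmetric] V(1)[symmetric] by (auto intro: SUP_upper)
  have level: "emeasure lborel {x. ennreal (U * s) < u x} + emeasure lborel {x. ennreal (V * s) < v x}
      \<le> 2 * emeasure lborel {x. ennreal (W * s) < w x}" if s: "s \<in> {0<..<1}" for s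
  proof (rule brunn_minkowski_midpoint_real)
    have "ennreal (U * s) < (SUP x. u x)" "ennreal (V * s) < (SUP x. v x)"
      using s U V by (simp_all add: ennreal_less_iff)
    then show "{x. ennreal (U * s) < u x} \<noteq> {}" "{x. ennreal (V * s) < v x} \<noteq> {}"
      by (auto simp: less_SUP_iff)
  next
    fix a b assume ab: "a \<in> {x. ennreal (U * s) < u x}" "b \<in> {x. ennreal (V * s) < v x}"
    obtain a' b' where a': "u a = ennreal a'" "0 \<le> a'" and b': "v b = ennreal b'" "0 \<le> b'"
      using u_le[of a] v_le[of b] by (cases "u a"; cases "v b") (auto simp: top_unique)
    have *: "U * s < a'" "V * s < b'" "0 < U * s" "0 < V * s"
      using ab a' b' s U V by (auto simp: ennreal_less_iff)
    have "(W * s)\<^sup>2 = (U * s) * (V * s)"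
      by (simp add: power_mult_distrib W) (simp add: power2_eq_square)
    also have "\<dots> < a' * b'" using * by (intro mult_strict_mono) auto
    finally have "(ennreal (W * s))\<^sup>2 < u a * v b"
      using a' b' W s by (simp add: ennreal_power ennreal_less_iff flip: ennreal_mult)
    also have "\<dots> \<le> (w ((a + b) / 2))\<^sup>2" by (rule le)
    finally have "\<not> w ((a + b) / 2) \<le> ennreal (W * s)"
      by (meson leD power_mono zero_le)
    then show "(a + b) / 2 \<in> {x. ennreal (W * s) < w x}" by simp
  qed measurable
  let ?I = "indicator {0<..<1} :: real \<Rightarrow> ennreal"
  have trunc: "min (u x / ennreal U) 1 = u x / ennreal U" "min (v x / ennreal V) 1 = v x / ennreal V" for x
    using u_le[of x] v_le[of x] U V by (simp_all add: min_def divide_le_posI_ennreal)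
  have "(\<integral>\<^sup>+x. u x / ennreal U \<partial>lborel) + (\<integral>\<^sup>+x. v x / ennreal V \<partial>lborel)
     = (\<integral>\<^sup>+s. (emeasure lborel {x. ennreal (U * s) < u x} + emeasure lborel {x. ennreal (V * s) < v x}) * ?I s \<partial>lborel)"
    unfolding distrib_right using U V
    by (subst nn_integral_add) (simp_all add: layer_cake_truncated trunc)
  also have "\<dots> \<le> (\<integral>\<^sup>+s. 2 * (emeasure lborel {x. ennreal (W * s) < w x} * ?I s) \<partial>lborel)"
    using level by (intro nn_integral_mono) (simp add: indicator_def)
  also have "\<dots> = 2 * (\<integral>\<^sup>+x. min (w x / ennreal W) 1 \<partial>lborel)"
    using W by (subst nn_integral_cmult) (simp_all add: layer_cake_truncated)
  also have "\<dots> \<le> 2 * (\<integral>\<^sup>+x. w x / ennreal W \<partial>lborel)"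
    by (intro mult_left_mono nn_integral_mono) auto
  finally have "integral\<^sup>N lborel u / ennreal U * (integral\<^sup>N lborel v / ennreal V) \<le> (integral\<^sup>N lborel w / ennreal W)\<^sup>2"
    by (intro ennreal_mult_le_square_mean) (simp add: nn_integral_divide)
  then have "(ennreal U * (integral\<^sup>N lborel u / ennreal U)) * (ennreal V * (integral\<^sup>N lborel v / ennreal V))
     \<le> (ennreal W * (integral\<^sup>N lborel w / ennreal W))\<^sup>2"
    using W U V by (simp add: power_mult_distrib ennreal_power ennreal_mult mult_ac mult_left_mono)
  moreover have "ennreal c * (x / ennreal c) = x" if "0 < c" for c x
    using that mult_divide_eq_ennreal[of "ennreal c" x] by (simp add: ennreal_times_divide mult.commute)
  ultimately show ?thesis using U(2) V(2) W(1) by simp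
qed

lemma prekopa_leindler_midpoint_real:
  fixes u v w :: "real \<Rightarrow> ennreal"
  assumes [measurable]: "u \<in> borel_measurable borel" "v \<in> borel_measurable borel" "w \<in> borel_measurable borel"
    and le: "\<And>x y. u x * v y \<le> (w ((x + y) / 2))\<^sup>2"
  shows "integral\<^sup>N lborel u * integral\<^sup>N lborel v \<le> (integral\<^sup>N lborel w)\<^sup>2"
proof -
  \<comment> \<open>The hypothesis survives truncating \<open>u\<close> and \<open>v\<close>, so the bounded case and monotone convergence suffice.\<close>
  have trunc: "integral\<^sup>N lborel f = (SUP n. \<integral>\<^sup>+x. min (f x) (of_nat n) \<partial>lborel)"
    if [measurable]: "f \<in> borel_measurable borel" for f :: "real \<Rightarrow> ennreal"
  proof -
    have "integral\<^sup>N lborel f = (\<integral>\<^sup>+x. (SUP n. min (f x) (of_nat n)) \<partial>lborel)"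
      by (simp add: inf_min[symmetric] inf_SUP[symmetric] ennreal_SUP_of_nat_eq_top)
    also have "\<dots> = (SUP n. \<integral>\<^sup>+x. min (f x) (of_nat n) \<partial>lborel)"
      by (intro nn_integral_monotone_convergence_SUP)
         (auto simp: incseq_def le_fun_def intro: min.coboundedI2)
    finally show ?thesis .
  qed
  have *: "(\<integral>\<^sup>+x. min (u x) (of_nat m) \<partial>lborel) * (\<integral>\<^sup>+x. min (v x) (of_nat n) \<partial>lborel) \<le> (integral\<^sup>N lborel w)\<^sup>2"
    for m n :: nat
  proof (rule prekopa_leindler_midpoint_bounded_real)
    show "min (u x) (of_nat m) * min (v y) (of_nat n) \<le> (w ((x + y) / 2))\<^sup>2" for x y
      by (rule order_trans[OF mult_mono le]) auto
    have "(SUP x. min (f x) (of_nat k)) \<le> of_nat k" for f :: "real \<Rightarrow> ennreal" and k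
      by (intro SUP_least) auto
    then show "(SUP x. min (u x) (of_nat m)) \<noteq> top" "(SUP x. min (v x) (of_nat n)) \<noteq> top"
      by (metis ennreal_of_nat_neq_top top_unique)+
  qed measurable
  show ?thesis
    unfolding trunc[of u, OF assms(1)] trunc[of v, OF assms(2)] SUP_mult_right_ennreal SUP_mult_left_ennreal
    by (intro SUP_least *)
qed

text \<open>
  Integrating out one coordinate preserves the hypothesis: by the one-dimensional case, the
  partial integrals of \<open>u\<close>, \<open>v\<close>, \<open>w\<close> satisfy it in the remaining coordinates. Extended
  nonnegative values are essential here, since partial integrals may be infinite.
\<close>

lemma prekopa_leindler_midpoint_PiM:
  fixes u v w :: "('i \<Rightarrow> real) \<Rightarrow> ennreal"
  assumes "finite I"
    and "u \<in> borel_measurable (Pi\<^sub>M I (\<lambda>_. lborel))" "v \<in> borel_measurable (Pi\<^sub>M I (\<lambda>_. lborel))"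
      "w \<in> borel_measurable (Pi\<^sub>M I (\<lambda>_. lborel))"
    and "\<And>x y. x \<in> space (Pi\<^sub>M I (\<lambda>_. lborel :: real measure)) \<Longrightarrow> y \<in> space (Pi\<^sub>M I (\<lambda>_. lborel :: real measure)) \<Longrightarrow>
      u x * v y \<le> (w (\<lambda>i\<in>I. (x i + y i) / 2))\<^sup>2"
  shows "integral\<^sup>N (Pi\<^sub>M I (\<lambda>_. lborel)) u * integral\<^sup>N (Pi\<^sub>M I (\<lambda>_. lborel)) v
    \<le> (integral\<^sup>N (Pi\<^sub>M I (\<lambda>_. lborel)) w)\<^sup>2"
  using assms
proof (induction I arbitrary: u v w rule: finite_induct)
  case empty
  interpret product_sigma_finite "\<lambda>_::'i. lborel :: real measure" ..
  show ?case using empty(4)[of "\<lambda>_. undefined" "\<lambda>_. undefined"]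
    by (simp add: nn_integral_empty space_PiM restrict_def)
next
  case (insert i I)
  interpret product_sigma_finite "\<lambda>_::'i. lborel :: real measure" ..
  note [measurable] = insert.prems(1-3)
  show ?case
    unfolding product_nn_integral_insert[OF insert(1,2) insert.prems(1)]
      product_nn_integral_insert[OF insert(1,2) insert.prems(2)]
      product_nn_integral_insert[OF insert(1,2) insert.prems(3)]
  proof (rule insert.IH)
    fix x y :: "'i \<Rightarrow> real"
    assume xy: "x \<in> space (Pi\<^sub>M I (\<lambda>_. lborel :: real measure))" "y \<in> space (Pi\<^sub>M I (\<lambda>_. lborel :: real measure))"
    have [measurable]: "(\<lambda>t. z(i := t)) \<in> measurable borel (Pi\<^sub>M (insert i I) (\<lambda>_. lborel :: real measure))"
      if "z \<in> space (Pi\<^sub>M I (\<lambda>_. lborel :: real measure))" for z :: "'i \<Rightarrow> real"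
      using that measurable_component_update[of z I "\<lambda>_. lborel :: real measure" i] insert(2)
      by simp
    let ?m = "\<lambda>j\<in>I. (x j + y j) / 2"
    have m: "?m \<in> space (Pi\<^sub>M I (\<lambda>_. lborel :: real measure))" by (simp add: space_PiM)
    show "(\<integral>\<^sup>+t. u (x(i := t)) \<partial>lborel) * (\<integral>\<^sup>+t. v (y(i := t)) \<partial>lborel)
        \<le> (\<integral>\<^sup>+t. w (?m(i := t)) \<partial>lborel)\<^sup>2"
    proof (rule prekopa_leindler_midpoint_real)
      fix s t :: real
      have "(\<lambda>j\<in>insert i I. ((x(i := s)) j + (y(i := t)) j) / 2) = ?m(i := (s + t) / 2)"
        using insert(2) by (auto simp: fun_eq_iff)
      moreover have "x(i := s) \<in> space (Pi\<^sub>M (insert i I) (\<lambda>_. lborel :: real measure))"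
        "y(i := t) \<in> space (Pi\<^sub>M (insert i I) (\<lambda>_. lborel :: real measure))"
        using xy by (auto simp: space_PiM PiE_def extensional_def)
      ultimately show "u (x(i := s)) * v (y(i := t)) \<le> (w (?m(i := (s + t) / 2)))\<^sup>2"
        using insert.prems(4) by metis
    qed (use xy m in measurable)
  qed measurable
qed

text \<open>
  A functional Brunn--Minkowski inequality, the case of equal weights. The hypothesis is
  written with a square in place of a geometric mean so that no roots in \<open>ennreal\<close> occur.
\<close>

lemma prekopa_leindler_midpoint:
  fixes u v w :: "'a::euclidean_space \<Rightarrow> ennreal"
  assumes [measurable]: "u \<in> borel_measurable borel" "v \<in> borel_measurable borel" "w \<in> borel_measurable borel"
    and le: "\<And>x y. u x * v y \<le> (w ((1 / 2) *\<^sub>R (x + y)))\<^sup>2"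
  shows "integral\<^sup>N lborel u * integral\<^sup>N lborel v \<le> (integral\<^sup>N lborel w)\<^sup>2"
proof -
  let ?M = "Pi\<^sub>M (Basis :: 'a set) (\<lambda>_. lborel :: real measure)"
  let ?T = "\<lambda>f. \<Sum>b\<in>Basis. f b *\<^sub>R b :: 'a"
  have [measurable]: "?T \<in> measurable ?M borel" by measurable
  have I: "integral\<^sup>N lborel g = (\<integral>\<^sup>+f. g (?T f) \<partial>?M)" if [measurable]: "g \<in> borel_measurable borel" for g :: "'a \<Rightarrow> ennreal"
    by (subst lborel_eq) (simp add: nn_integral_distr)
  show ?thesis
    unfolding I[OF assms(1)] I[OF assms(2)] I[OF assms(3)]
  proof (rule prekopa_leindler_midpoint_PiM)
    fix x y :: "'a \<Rightarrow> real"
    have "?T (\<lambda>i\<in>Basis. (x i + y i) / 2) = (1 / 2) *\<^sub>R (?T x + ?T y)"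
      by (simp add: scaleR_sum_right scaleR_add_right flip: sum.distrib) (simp add: scaleR_add_left[symmetric] add_divide_distrib)
    then show "u (?T x) * v (?T y) \<le> (w (?T (\<lambda>i\<in>Basis. (x i + y i) / 2)))\<^sup>2"
      using le[of "?T x" "?T y"] by simp
  qed auto
qed

section \<open>Deviation inequality for Gaussian measures\<close>

lemma nn_integral_gaussian_real:
  fixes t :: real
  assumes "0 < t"
  shows "(\<integral>\<^sup>+x. ennreal (exp (- t * x\<^sup>2)) \<partial>lborel) = ennreal (sqrt (pi / t))"
proof -
  define \<sigma> where "\<sigma> = 1 / sqrt (2 * t)"
  have \<sigma>: "0 < \<sigma>" "\<sigma>\<^sup>2 = 1 / (2 * t)" using assms by (simp_all add: \<sigma>_def power_divide)
  have "exp (- t * x\<^sup>2) = sqrt (pi / t) * normal_density 0 \<sigma> x" for x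
    using assms by (simp add: normal_density_def \<sigma> real_sqrt_divide mult.commute)
  then have "(\<integral>\<^sup>+x. ennreal (exp (- t * x\<^sup>2)) \<partial>lborel) = ennreal (sqrt (pi / t)) * (\<integral>\<^sup>+x. ennreal (normal_density 0 \<sigma> x) \<partial>lborel)"
    using assms by (simp add: ennreal_mult nn_integral_cmult)
  also have "(\<integral>\<^sup>+x. ennreal (normal_density 0 \<sigma> x) \<partial>lborel) = 1"
    using prob_space.emeasure_space_1[OF prob_space_normal_density[OF \<sigma>(1), of 0]]
    by (simp add: emeasure_density)
  finally show ?thesis by simp
qed

lemma nn_integral_gaussian:
  fixes t :: real
  assumes "0 < t"
  shows "(\<integral>\<^sup>+x. ennreal (exp (- t * (norm (x :: 'a::euclidean_space))\<^sup>2)) \<partial>lborel)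
    = ennreal ((pi / t) powr (real DIM('a) / 2))"
proof -
  have "(norm x)\<^sup>2 = (\<Sum>b\<in>Basis. (x \<bullet> b)\<^sup>2)" for x :: 'a
    unfolding power2_norm_eq_inner by (subst euclidean_inner) (simp add: power2_eq_square)
  then have "ennreal (exp (- t * (norm x)\<^sup>2)) = (\<Prod>b\<in>Basis. ennreal (exp (- t * (x \<bullet> b)\<^sup>2)))" for x :: 'a
    by (simp add: sum_distrib_left exp_sum prod_ennreal flip: sum_negf)
  then have "(\<integral>\<^sup>+x. ennreal (exp (- t * (norm (x :: 'a))\<^sup>2)) \<partial>lborel) = ennreal (sqrt (pi / t)) ^ DIM('a)"
    using assms nn_integral_lborel_prod[of "\<lambda>(_::'a) x. ennreal (exp (- t * x\<^sup>2))"]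
    by (simp add: nn_integral_gaussian_real[OF assms, simplified])
  also have "\<dots> = ennreal ((pi / t) powr (real DIM('a) / 2))"
    using assms by (simp add: ennreal_power powr_half_sqrt[symmetric] powr_realpow[symmetric] powr_powr)
  finally show ?thesis .
qed

text \<open>
  Prekopa--Leindler for \<open>exp (l * f)\<close> and \<open>exp (- l * f)\<close> times the Gaussian weight. By the
  parallelogram law the Gaussian weight at \<open>x\<close> and \<open>y\<close> beats its square at the midpoint by the
  factor \<open>exp (- t * (norm (x - y))\<^sup>2 / 2)\<close>, which pays for \<open>l * (f x - f y) \<le> \<bar>l\<bar> * norm (x - y)\<close>
  up to the constant \<open>l\<^sup>2 / (2 * t)\<close>. The constant does not depend on the dimension, and no
  differentiability of \<open>f\<close> is used.
\<close>

lemma gaussian_exponential_moments_lipschitz: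
  fixes f :: "'a::euclidean_space \<Rightarrow> real"
  assumes lip: "1-lipschitz_on UNIV f" and t: "0 < t"
  shows "(\<integral>\<^sup>+x. ennreal (exp (l * f x - t * (norm x)\<^sup>2)) \<partial>lborel)
       * (\<integral>\<^sup>+x. ennreal (exp (- l * f x - t * (norm x)\<^sup>2)) \<partial>lborel)
    \<le> ennreal (exp (l\<^sup>2 / (2 * t)) * (pi / t) powr real DIM('a))"
proof -
  have [measurable]: "f \<in> borel_measurable borel"
    using lipschitz_on_continuous_on[OF lip] by (rule borel_measurable_continuous_onI)
  let ?w = "\<lambda>x::'a. ennreal (exp (l\<^sup>2 / (4 * t)) * exp (- t * (norm x)\<^sup>2))"
  have "(\<integral>\<^sup>+x. ennreal (exp (l * f x - t * (norm x)\<^sup>2)) \<partial>lborel)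
       * (\<integral>\<^sup>+x. ennreal (exp (- l * f x - t * (norm x)\<^sup>2)) \<partial>lborel) \<le> (\<integral>\<^sup>+x. ?w x \<partial>lborel)\<^sup>2"
  proof (rule prekopa_leindler_midpoint)
    fix x y :: 'a
    define d where "d = norm (x - y)"
    have par: "(norm x)\<^sup>2 + (norm y)\<^sup>2 = 2 * (norm ((1 / 2) *\<^sub>R (x + y)))\<^sup>2 + d\<^sup>2 / 2"
      by (simp add: d_def power2_norm_eq_inner inner_add inner_diff inner_commute power_divide) (simp add: field_simps)
    have "l * (f x - f y) \<le> \<bar>l\<bar> * d"
      using lipschitz_onD[OF lip, of x y] abs_le_D1[OF order_refl, of "l * (f x - f y)"]
      by (simp add: d_def dist_norm abs_mult) (meson abs_ge_zero mult_left_mono order_trans)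
    also have "\<dots> \<le> l\<^sup>2 / (2 * t) + t * d\<^sup>2 / 2"
    proof -
      have "0 \<le> (\<bar>l\<bar> - t * d)\<^sup>2 / (2 * t)" using t by simp
      also have "\<dots> = l\<^sup>2 / (2 * t) + t * d\<^sup>2 / 2 - \<bar>l\<bar> * d"
        using t by (simp add: power2_eq_square field_simps)
      finally show ?thesis by simp
    qed
    finally have "(l * f x - t * (norm x)\<^sup>2) + (- l * f y - t * (norm y)\<^sup>2)
        \<le> l\<^sup>2 / (2 * t) + t * d\<^sup>2 / 2 - t * ((norm x)\<^sup>2 + (norm y)\<^sup>2)"
      by (simp add: algebra_simps)
    also have "\<dots> = 2 * (l\<^sup>2 / (4 * t) + - t * (norm ((1 / 2) *\<^sub>R (x + y)))\<^sup>2)"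
      unfolding par using t by (simp add: field_simps)
    finally show "ennreal (exp (l * f x - t * (norm x)\<^sup>2)) * ennreal (exp (- l * f y - t * (norm y)\<^sup>2))
        \<le> (?w ((1 / 2) *\<^sub>R (x + y)))\<^sup>2"
      by (simp only: ennreal_mult[symmetric] exp_ge_zero ennreal_power exp_add[symmetric] exp_double[symmetric])
         (simp add: ennreal_leI)
  qed measurable
  also have "(\<integral>\<^sup>+x. ?w x \<partial>lborel) = ennreal (exp (l\<^sup>2 / (4 * t)) * (pi / t) powr (real DIM('a) / 2))"
    using nn_integral_gaussian[OF t, where 'a='a] by (simp add: ennreal_mult nn_integral_cmult)
  also have "(ennreal (exp (l\<^sup>2 / (4 * t)) * (pi / t) powr (real DIM('a) / 2)))\<^sup>2
      = ennreal (exp (l\<^sup>2 / (2 * t)) * (pi / t) powr real DIM('a))"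
  proof -
    have "(exp (l\<^sup>2 / (4 * t)))\<^sup>2 = exp (l\<^sup>2 / (2 * t))" "((pi / t) powr (real DIM('a) / 2))\<^sup>2 = (pi / t) powr real DIM('a)"
      by (simp_all add: field_simps flip: exp_double) (simp add: power2_eq_square flip: powr_add)
    then show ?thesis by (simp add: ennreal_power power_mult_distrib)
  qed
  finally show ?thesis .
qed

text \<open>
  Chernoff's bound for two independent Gaussian vectors; \<open>l = t * r\<close> minimises
  \<open>l\<^sup>2 / (2 * t) - l * r\<close>. The weight is left unnormalised, so its total mass
  \<open>(pi / t) powr DIM('a)\<close> stays in the bound.
\<close>

lemma gaussian_deviation_one_sided:
  fixes f :: "'a::euclidean_space \<Rightarrow> real"
  assumes lip: "1-lipschitz_on UNIV f" and t: "0 < t" and r: "0 \<le> r"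
  shows "(\<integral>\<^sup>+z. ennreal (exp (- t * (norm z)\<^sup>2)) * indicator {(x, y). r \<le> f x - f y} z \<partial>lborel)
    \<le> ennreal (exp (- t * (r\<^sup>2 / 2)) * (pi / t) powr real DIM('a))"
proof -
  have [measurable]: "f \<in> borel_measurable borel"
    using lipschitz_on_continuous_on[OF lip] by (rule borel_measurable_continuous_onI)
  define l where "l = t * r"
  let ?p = "\<lambda>x. ennreal (exp (l * f x - t * (norm x)\<^sup>2))" and ?q = "\<lambda>y. ennreal (exp (- l * f y - t * (norm y)\<^sup>2))"
  have "(\<integral>\<^sup>+z. ennreal (exp (- t * (norm z)\<^sup>2)) * indicator {(x, y). r \<le> f x - f y} z \<partial>lborel)
      \<le> (\<integral>\<^sup>+(x, y). ennreal (exp (- l * r)) * (?p x * ?q y) \<partial>lborel)"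
  proof (rule nn_integral_mono, clarify)
    fix x y :: 'a
    have "exp (- t * (norm (x, y))\<^sup>2) \<le> exp (- l * r) * (exp (l * f x - t * (norm x)\<^sup>2) * exp (- l * f y - t * (norm y)\<^sup>2))"
      if "r \<le> f x - f y"
    proof -
      have "l * r \<le> l * (f x - f y)" using that t r by (intro mult_left_mono) (auto simp: l_def)
      then show ?thesis
        by (simp add: exp_add[symmetric] norm_Pair algebra_simps)
    qed
    then show "ennreal (exp (- t * (norm (x, y))\<^sup>2)) * indicator {(x, y). r \<le> f x - f y} (x, y)
        \<le> ennreal (exp (- l * r)) * (?p x * ?q y)"
      by (auto simp: indicator_def ennreal_leI simp flip: ennreal_mult)
  qed
  also have "\<dots> = ennreal (exp (- l * r)) * (integral\<^sup>N lborel ?p * integral\<^sup>N lborel ?q)"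
  proof -
    have "(\<integral>\<^sup>+(x, y). ennreal (exp (- l * r)) * (?p x * ?q y) \<partial>(lborel \<Otimes>\<^sub>M lborel))
      = (\<integral>\<^sup>+x. \<integral>\<^sup>+y. ennreal (exp (- l * r)) * (?p x * ?q y) \<partial>lborel \<partial>lborel)"
      by (subst lborel.nn_integral_fst[symmetric]) (simp_all add: split_beta')
    then show ?thesis
      by (simp add: lborel_prod nn_integral_cmult nn_integral_multc)
  qed
  also have "\<dots> \<le> ennreal (exp (- l * r)) * ennreal (exp (l\<^sup>2 / (2 * t)) * (pi / t) powr real DIM('a))"
    by (intro mult_left_mono gaussian_exponential_moments_lipschitz lip t) simp
  also have "\<dots> = ennreal (exp (- t * (r\<^sup>2 / 2)) * (pi / t) powr real DIM('a))"
  proof -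
    have "- l * r + l\<^sup>2 / (2 * t) = - t * (r\<^sup>2 / 2)"
      using t by (simp add: l_def power2_eq_square field_simps)
    then show ?thesis
      by (simp add: mult.assoc[symmetric] exp_add[symmetric] flip: ennreal_mult)
  qed
  finally show ?thesis .
qed

lemma sets_borel_difference_ge:
  fixes f :: "'a::second_countable_topology \<Rightarrow> real"
  assumes [measurable]: "f \<in> borel_measurable borel"
  shows "{(x, y). r \<le> f x - f y} \<in> sets borel"
proof -
  have "{(x, y). r \<le> f x - f y} = {z \<in> space (borel \<Otimes>\<^sub>M borel). r \<le> f (fst z) - f (snd z)}"
    by (auto simp: space_pair_measure)
  also have "\<dots> \<in> sets (borel \<Otimes>\<^sub>M borel)" by measurable
  finally show ?thesis unfolding borel_prod .
qed

lemma gaussian_deviation: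
  fixes f :: "'a::euclidean_space \<Rightarrow> real"
  assumes lip: "1-lipschitz_on UNIV f" and t: "0 < t" and r: "0 \<le> r"
  shows "(\<integral>\<^sup>+z. ennreal (exp (- t * (norm z)\<^sup>2)) * indicator {(x, y). r \<le> \<bar>f x - f y\<bar>} z \<partial>lborel)
    \<le> ennreal (2 * exp (- t * (r\<^sup>2 / 2)) * (pi / t) powr real DIM('a))"
proof -
  have [measurable]: "f \<in> borel_measurable borel"
    using lipschitz_on_continuous_on[OF lip] by (rule borel_measurable_continuous_onI)
  have lip': "1-lipschitz_on UNIV (\<lambda>x. - f x)"
    using lip by (simp add: lipschitz_on_def dist_real_def abs_minus_commute)
  let ?e = "\<lambda>z :: 'a \<times> 'a. ennreal (exp (- t * (norm z)\<^sup>2))"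
  have [measurable]: "{(x, y). r \<le> f x - f y} \<in> sets borel" "{(x, y). r \<le> - f x - (- f y)} \<in> sets borel"
    using sets_borel_difference_ge[of f r] sets_borel_difference_ge[of "\<lambda>x. - f x" r] by simp_all
  have "(\<integral>\<^sup>+z. ?e z * indicator {(x, y). r \<le> \<bar>f x - f y\<bar>} z \<partial>lborel)
    \<le> (\<integral>\<^sup>+z. ?e z * indicator {(x, y). r \<le> f x - f y} z + ?e z * indicator {(x, y). r \<le> - f x - (- f y)} z \<partial>lborel)"
    by (intro nn_integral_mono) (auto simp: indicator_def)
  also have "\<dots> = (\<integral>\<^sup>+z. ?e z * indicator {(x, y). r \<le> f x - f y} z \<partial>lborel)
      + (\<integral>\<^sup>+z. ?e z * indicator {(x, y). r \<le> - f x - (- f y)} z \<partial>lborel)"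
    by (rule nn_integral_add) measurable
  also have "\<dots> \<le> ennreal (exp (- t * (r\<^sup>2 / 2)) * (pi / t) powr real DIM('a))
      + ennreal (exp (- t * (r\<^sup>2 / 2)) * (pi / t) powr real DIM('a))"
    by (intro add_mono gaussian_deviation_one_sided lip lip' t r)
  finally show ?thesis by (simp add: mult_ac flip: ennreal_plus)
qed

section \<open>Cauchy measures as Gaussian mixtures\<close>

lemma nn_integral_Gamma_scaled:
  fixes a s :: real
  assumes a: "0 < a" and s: "0 < s"
  shows "(\<integral>\<^sup>+t. ennreal (t powr (a - 1) * exp (- s * t)) * indicator {0<..} t \<partial>lborel)
    = ennreal (Gamma a * s powr (- a))"
proof -
  have "ennreal (Gamma a) = ennreal s * (\<integral>\<^sup>+t. ennreal (indicator {0..} (s * t) * (s * t) powr (a - 1) / exp (s * t)) \<partial>lborel)"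
    using s by (subst Gamma_conv_nn_integral_real[OF a], subst nn_integral_real_affine[of _ s 0]) auto
  also have "(\<integral>\<^sup>+t. ennreal (indicator {0..} (s * t) * (s * t) powr (a - 1) / exp (s * t)) \<partial>lborel)
    = (\<integral>\<^sup>+t. ennreal (s powr (a - 1)) * (ennreal (t powr (a - 1) * exp (- s * t)) * indicator {0<..} t) \<partial>lborel)"
    using s by (intro nn_integral_cong)
      (auto simp: indicator_def powr_mult zero_le_mult_iff exp_minus field_simps simp flip: ennreal_mult)
  also have "\<dots> = ennreal (s powr (a - 1)) * (\<integral>\<^sup>+t. ennreal (t powr (a - 1) * exp (- s * t)) * indicator {0<..} t \<partial>lborel)"
    by (rule nn_integral_cmult) measurable
  finally have "ennreal (s powr (- a)) * ennreal (Gamma a) = ennreal (s powr (- a) * (s * s powr (a - 1))) *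
      (\<integral>\<^sup>+t. ennreal (t powr (a - 1) * exp (- s * t)) * indicator {0<..} t \<partial>lborel)"
    using s by (simp add: ennreal_mult mult.assoc)
  moreover have "s powr (- a) * (s * s powr (a - 1)) = 1"
    using s by (simp add: powr_diff powr_minus field_simps)
  ultimately show ?thesis
    using Gamma_real_pos[OF a] by (simp add: mult.commute flip: ennreal_mult)
qed

text \<open>
  The identity \<open>(1 + s) powr (- \<alpha>) = (\<integral> t powr (\<alpha> - 1) * exp (- (1 + s) * t) dt) / Gamma \<alpha>\<close>
  at \<open>s = (norm z)\<^sup>2\<close> exhibits the Cauchy measure as a mixture of Gaussian measures, in which half
  the inverse variance is Gamma distributed with parameter \<open>\<alpha> - DIM('a) / 2\<close>. A factor
  \<open>exp (- t * s)\<close> common to all the Gaussian bounds integrates to the Laplace transform of that Gamma law.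
\<close>

lemma cauchy_measure_le_of_gaussian_bound:
  fixes A :: "'a::euclidean_space set"
  assumes [measurable]: "A \<in> sets borel" and \<alpha>: "real DIM('a) / 2 < \<alpha>"
    and K: "0 \<le> K" and s: "0 \<le> s"
    and gauss: "\<And>t. 0 < t \<Longrightarrow> (\<integral>\<^sup>+z. ennreal (exp (- t * (norm z)\<^sup>2)) * indicator A z \<partial>lborel)
      \<le> ennreal (K * exp (- t * s) * (pi / t) powr (real DIM('a) / 2))"
  shows "emeasure (cauchy_measure \<alpha> :: 'a measure) A \<le> ennreal (K * (1 + s) powr (- (\<alpha> - real DIM('a) / 2)))"
proof -
  define k where "k = real DIM('a) / 2"
  have k: "0 < k" "k < \<alpha>" using \<alpha> by (simp_all add: k_def)
  define C where "C = 1 / (pi powr k * Gamma (\<alpha> - k))"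
  have C: "0 < C" using k Gamma_real_pos[of "\<alpha> - k"] by (simp add: C_def)
  let ?g = "\<lambda>t. ennreal (t powr (\<alpha> - 1) * exp (- t)) * indicator {0<..} t"
  have mix: "ennreal (1 / cauchy_const DIM('a) \<alpha> * (1 + (norm z)\<^sup>2) powr (- \<alpha>))
      = ennreal C * (\<integral>\<^sup>+t. ?g t * ennreal (exp (- t * (norm z)\<^sup>2)) \<partial>lborel)" for z :: 'a
  proof -
    have "(\<integral>\<^sup>+t. ?g t * ennreal (exp (- t * (norm z)\<^sup>2)) \<partial>lborel)
       = (\<integral>\<^sup>+t. ennreal (t powr (\<alpha> - 1) * exp (- (1 + (norm z)\<^sup>2) * t)) * indicator {0<..} t \<partial>lborel)"
      by (intro nn_integral_cong)
         (auto simp: indicator_def exp_add[symmetric] algebra_simps simp flip: ennreal_mult)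
    also have "\<dots> = ennreal (Gamma \<alpha> * (1 + (norm z)\<^sup>2) powr (- \<alpha>))"
      using k by (intro nn_integral_Gamma_scaled) (auto intro: add_pos_nonneg)
    also have "ennreal C * \<dots> = ennreal (C * Gamma \<alpha> * (1 + (norm z)\<^sup>2) powr (- \<alpha>))"
      using C by (simp add: mult.assoc ennreal_mult')
    also have "C * Gamma \<alpha> = 1 / cauchy_const DIM('a) \<alpha>"
      by (simp add: C_def cauchy_const_def k_def)
    finally show ?thesis by simp
  qed
  have "emeasure (cauchy_measure \<alpha> :: 'a measure) A
      = (\<integral>\<^sup>+z. ennreal C * (\<integral>\<^sup>+t. ?g t * (ennreal (exp (- t * (norm z)\<^sup>2)) * indicator A z) \<partial>lborel) \<partial>lborel)"
    unfolding cauchy_measure_def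
  proof (subst emeasure_density)
    show "(\<integral>\<^sup>+z. ennreal (1 / cauchy_const DIM('a) \<alpha> * (1 + (norm z)\<^sup>2) powr (- \<alpha>)) * indicator A z \<partial>lborel)
      = (\<integral>\<^sup>+z. ennreal C * (\<integral>\<^sup>+t. ?g t * (ennreal (exp (- t * (norm z)\<^sup>2)) * indicator A z) \<partial>lborel) \<partial>lborel)"
      unfolding mix by (simp add: nn_integral_multc[symmetric] mult.assoc)
  qed measurable
  also have "\<dots> = ennreal C * (\<integral>\<^sup>+z. \<integral>\<^sup>+t. ?g t * (ennreal (exp (- t * (norm z)\<^sup>2)) * indicator A z) \<partial>lborel \<partial>lborel)"
    by (rule nn_integral_cmult) measurable
  finally have mass: "emeasure (cauchy_measure \<alpha> :: 'a measure) A
      = ennreal C * (\<integral>\<^sup>+z. \<integral>\<^sup>+t. ?g t * (ennreal (exp (- t * (norm z)\<^sup>2)) * indicator A z) \<partial>lborel \<partial>lborel)" .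
  have "(\<integral>\<^sup>+z. \<integral>\<^sup>+t. ?g t * (ennreal (exp (- t * (norm z)\<^sup>2)) * indicator A z) \<partial>lborel \<partial>lborel)
     = (\<integral>\<^sup>+t. \<integral>\<^sup>+z. ?g t * (ennreal (exp (- t * (norm z)\<^sup>2)) * indicator A z) \<partial>lborel \<partial>lborel)"
    by (intro lborel_pair.Fubini') measurable
  also have "\<dots> = (\<integral>\<^sup>+t. ?g t * (\<integral>\<^sup>+z. ennreal (exp (- t * (norm z)\<^sup>2)) * indicator A z \<partial>lborel) \<partial>lborel)"
    by (intro nn_integral_cong nn_integral_cmult) measurable
  also have "\<dots> \<le> (\<integral>\<^sup>+t. ennreal (K * pi powr k) *
      (ennreal (t powr (\<alpha> - k - 1) * exp (- (1 + s) * t)) * indicator {0<..} t) \<partial>lborel)"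
  proof (rule nn_integral_mono)
    fix t :: real
    show "?g t * (\<integral>\<^sup>+z. ennreal (exp (- t * (norm z)\<^sup>2)) * indicator A z \<partial>lborel)
        \<le> ennreal (K * pi powr k) * (ennreal (t powr (\<alpha> - k - 1) * exp (- (1 + s) * t)) * indicator {0<..} t)"
    proof (cases "0 < t")
      case True
      have "t powr (\<alpha> - 1) * exp (- t) * (K * exp (- t * s) * (pi / t) powr k)
          = K * pi powr k * (t powr (\<alpha> - k - 1) * exp (- (1 + s) * t))"
      proof -
        have "exp (- t) * exp (- t * s) = exp (- (1 + s) * t)"
          by (simp add: algebra_simps flip: exp_add)
        moreover have "t powr (\<alpha> - 1) * (pi / t) powr k = pi powr k * t powr (\<alpha> - k - 1)"
          using True by (simp add: powr_divide powr_diff powr_add field_simps)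
        moreover have "t powr (\<alpha> - 1) * exp (- t) * (K * exp (- t * s) * (pi / t) powr k)
            = K * (t powr (\<alpha> - 1) * (pi / t) powr k) * (exp (- t) * exp (- t * s))"
          by (simp only: mult_ac)
        ultimately show ?thesis by (simp only: mult.assoc)
      qed
      then have eq: "ennreal (t powr (\<alpha> - 1) * exp (- t)) * ennreal (K * exp (- t * s) * (pi / t) powr k)
          = ennreal (K * pi powr k) * ennreal (t powr (\<alpha> - k - 1) * exp (- (1 + s) * t))"
        using K by (simp only: ennreal_mult[symmetric] mult_nonneg_nonneg exp_ge_zero powr_ge_zero)
      show ?thesis
        using True mult_left_mono[OF gauss[OF True, folded k_def], of "ennreal (t powr (\<alpha> - 1) * exp (- t))"]
        unfolding eq by simp
    qed simp
  qed
  also have "\<dots> = ennreal (K * pi powr k) * ennreal (Gamma (\<alpha> - k) * (1 + s) powr (- (\<alpha> - k)))"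
  proof (subst nn_integral_cmult)
    show "(\<lambda>t. ennreal (t powr (\<alpha> - k - 1) * exp (- (1 + s) * t)) * indicator {0<..} t) \<in> borel_measurable lborel"
      by measurable
    have "0 < \<alpha> - k" "0 < 1 + s" using k s by simp_all
    then show "ennreal (K * pi powr k) * (\<integral>\<^sup>+t. ennreal (t powr (\<alpha> - k - 1) * exp (- (1 + s) * t)) * indicator {0<..} t \<partial>lborel)
        = ennreal (K * pi powr k) * ennreal (Gamma (\<alpha> - k) * (1 + s) powr (- (\<alpha> - k)))"
      by (simp only: nn_integral_Gamma_scaled)
  qed
  finally have "emeasure (cauchy_measure \<alpha> :: 'a measure) A
      \<le> ennreal C * (ennreal (K * pi powr k) * ennreal (Gamma (\<alpha> - k) * (1 + s) powr (- (\<alpha> - k))))"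
    unfolding mass by (rule mult_left_mono) simp
  also have "\<dots> = ennreal (K * (1 + s) powr (- (\<alpha> - k)))"
  proof -
    have "0 < Gamma (\<alpha> - k)" using k by (intro Gamma_real_pos) simp
    then have "C * (K * pi powr k * (Gamma (\<alpha> - k) * (1 + s) powr (- (\<alpha> - k)))) = K * (1 + s) powr (- (\<alpha> - k))"
      by (simp add: C_def)
    then show ?thesis
      using C K \<open>0 < Gamma (\<alpha> - k)\<close>
      by (simp only: ennreal_mult[symmetric] mult_nonneg_nonneg powr_ge_zero less_imp_le)
  qed
  finally show ?thesis unfolding k_def .
qed

section \<open>Normalising constants\<close>

lemma ln_Gamma_three_points:
  fixes p q r :: real
  assumes "0 < p" "p \<le> q" "q \<le> r" "p < r"
  shows "(r - p) * ln (Gamma q) \<le> (r - q) * ln (Gamma p) + (q - p) * ln (Gamma r)"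
proof -
  define l where "l = (q - p) / (r - p)"
  have l: "0 \<le> l" "l \<le> 1" "l * (r - p) = q - p" using assms by (simp_all add: l_def)
  have q: "(1 - l) *\<^sub>R p + l *\<^sub>R r = q" using l(3) by (simp add: algebra_simps)
  have "ln (Gamma q) \<le> (1 - l) * ln (Gamma p) + l * ln (Gamma r)"
    using convex_onD[OF log_convex_Gamma_real l(1,2), of p r] assms unfolding q by simp
  then have "(r - p) * ln (Gamma q) \<le> (r - p) * ((1 - l) * ln (Gamma p) + l * ln (Gamma r))"
    using assms by (intro mult_left_mono) auto
  also have "\<dots> = ((r - p) - l * (r - p)) * ln (Gamma p) + (l * (r - p)) * ln (Gamma r)"
    by (simp add: algebra_simps)
  finally show ?thesis unfolding l(3) by simp
qed

lemma ln_Gamma_plus1_real: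
  fixes x :: real
  assumes "0 < x"
  shows "ln (Gamma (x + 1)) = ln x + ln (Gamma x)"
proof -
  have "Gamma (x + 1) = x * Gamma x" using assms by (intro Gamma_plus1) auto
  moreover have "Gamma x \<noteq> 0" using Gamma_real_pos[OF assms] by linarith
  ultimately show ?thesis using assms by (simp add: ln_mult)
qed

text \<open>
  By log-convexity, the slope of \<open>ln Gamma\<close> on \<open>[\<alpha> - h, \<alpha>]\<close> is at most its increment
  \<open>ln \<alpha>\<close> over \<open>[\<alpha>, \<alpha> + 1]\<close>, and its slope on \<open>[\<alpha> - 2 * h, \<alpha> - h]\<close> is at least its
  increment \<open>ln (\<alpha> - 2 * h - 1)\<close> over the unit interval to the left.
\<close>

lemma Gamma_second_difference_le:
  fixes \<alpha> h :: real
  assumes h: "0 < h" and "1 < \<alpha> - 2 * h"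
  shows "Gamma (\<alpha> - 2 * h) * Gamma \<alpha> / (Gamma (\<alpha> - h))\<^sup>2 \<le> exp (h * (2 * h + 1) / (\<alpha> - 2 * h - 1))"
proof -
  let ?g = "\<lambda>x::real. ln (Gamma x)" and ?b = "\<alpha> - 2 * h"
  have up: "?g \<alpha> \<le> ?g (\<alpha> - h) + h * ln \<alpha>"
    using ln_Gamma_three_points[of "\<alpha> - h" \<alpha> "\<alpha> + 1"] ln_Gamma_plus1_real[of \<alpha>] assms
    by (simp add: algebra_simps)
  have lo: "?g ?b + h * ln (?b - 1) \<le> ?g (\<alpha> - h)"
    using ln_Gamma_three_points[of "?b - 1" ?b "\<alpha> - h"] ln_Gamma_plus1_real[of "?b - 1"] assms
    by (simp add: algebra_simps)
  have pos: "0 < Gamma ?b" "0 < Gamma \<alpha>" "0 < Gamma (\<alpha> - h)"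
    using assms by (auto intro!: Gamma_real_pos)
  have "ln (Gamma ?b * Gamma \<alpha> / (Gamma (\<alpha> - h))\<^sup>2) = ?g ?b + ?g \<alpha> - 2 * ?g (\<alpha> - h)"
    using pos by (simp add: ln_mult ln_div ln_realpow)
  also have "\<dots> \<le> h * (ln \<alpha> - ln (?b - 1))"
    using up lo by (simp add: algebra_simps)
  also have "ln \<alpha> - ln (?b - 1) = ln (\<alpha> / (?b - 1))"
    using assms by (simp add: ln_div)
  also have "\<dots> \<le> \<alpha> / (?b - 1) - 1"
    using assms by (intro ln_le_minus_one) auto
  also have "\<alpha> / (?b - 1) - 1 = (2 * h + 1) / (?b - 1)"
    using assms by (simp add: field_simps)
  finally have "ln (Gamma ?b * Gamma \<alpha> / (Gamma (\<alpha> - h))\<^sup>2) \<le> h * (2 * h + 1) / (?b - 1)"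
    using h by (simp add: mult_left_mono)
  then have "exp (ln (Gamma ?b * Gamma \<alpha> / (Gamma (\<alpha> - h))\<^sup>2)) \<le> exp (h * (2 * h + 1) / (?b - 1))"
    by simp
  then show ?thesis using pos by (simp del: exp_le_cancel_iff)
qed

text \<open>
  The powers of \<open>pi\<close> cancel, and the logarithm of the ratio is a second difference of \<open>ln Gamma\<close>
  with step \<open>n / 2\<close>. For large \<open>n\<close> it has order \<open>n\<^sup>2 / \<alpha>\<close>, so \<open>n\<^sup>2 \<le> \<alpha>\<close> keeps it bounded.
  The constant 3 is the value of the bound \<open>h * (2 * h + 1) / (\<alpha> - 2 * h - 1)\<close> with \<open>h = n / 2\<close> at
  its worst point, \<open>n = 2\<close> and \<open>\<alpha> = 4\<close>.
\<close>

lemma cauchy_const_ratio_le: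
  fixes n :: nat and \<alpha> :: real
  assumes "1 \<le> n" and \<alpha>: "real n + 3 / 2 \<le> \<alpha>" "(real n)\<^sup>2 \<le> \<alpha>"
  shows "cauchy_const (2 * n) \<alpha> / (cauchy_const n \<alpha>)\<^sup>2 \<le> exp 3"
proof -
  define h where "h = real n / 2"
  have h: "0 < h" "real n = 2 * h" using assms by (simp_all add: h_def)
  have "0 < Gamma \<alpha>" "0 < Gamma (\<alpha> - h)" "0 < Gamma (\<alpha> - 2 * h)"
    using assms h by (auto intro!: Gamma_real_pos)
  moreover have "(pi powr h)\<^sup>2 = pi powr (2 * h)"
    by (simp add: power2_eq_square flip: powr_add)
  ultimately have "cauchy_const (2 * n) \<alpha> / (cauchy_const n \<alpha>)\<^sup>2 = Gamma (\<alpha> - 2 * h) * Gamma \<alpha> / (Gamma (\<alpha> - h))\<^sup>2"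
    by (simp add: cauchy_const_def h(2) power_mult_distrib power_divide)
       (simp add: power2_eq_square field_simps)
  also have "\<dots> \<le> exp (h * (2 * h + 1) / (\<alpha> - 2 * h - 1))"
    using assms h by (intro Gamma_second_difference_le) auto
  also have "h * (2 * h + 1) / (\<alpha> - 2 * h - 1) \<le> 3"
  proof -
    have "real n * (real n + 1) \<le> 6 * (\<alpha> - real n - 1)"
    proof (cases "n = 1")
      case True
      then show ?thesis using \<alpha> by simp
    next
      case False
      then have "0 \<le> (real n - 2) * (5 * real n + 3)" using assms by simp
      then have "real n * (real n + 1) \<le> 6 * ((real n)\<^sup>2 - real n - 1)"
        by (simp add: power2_eq_square algebra_simps)
      then show ?thesis using \<alpha> by simp
    qed
    then show ?thesis using \<alpha> h by (simp add: field_simps)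
  qed
  finally show ?thesis by simp
qed

section \<open>Deviation inequality for Cauchy measures\<close>

text \<open>
  On the range \<open>t\<^sup>2 \<le> a\<close> the polynomial tail is still Gaussian: \<open>ln (1 + x) \<ge> x / (1 + x) \<ge> 2 / 3 * x\<close>
  for \<open>0 \<le> x \<le> 1 / 2\<close>.
\<close>

lemma one_plus_half_square_powr_le:
  fixes a t :: real
  assumes "0 < a" "t\<^sup>2 \<le> a"
  shows "(1 + t\<^sup>2 / a / 2) powr (- a) \<le> exp (- (t\<^sup>2 / 3))"
proof -
  define x where "x = t\<^sup>2 / a / 2"
  have x: "0 \<le> x" "x \<le> 1 / 2" "a * x = t\<^sup>2 / 2" using assms by (auto simp: x_def field_simps)
  have "2 / 3 * x \<le> x / (1 + x)"
    using x mult_left_mono[OF x(2) x(1)] by (simp add: field_simps)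
  also have "\<dots> \<le> ln (1 + x)"
    using ln_le_minus_one[of "1 / (1 + x)"] x by (simp add: ln_div field_simps)
  finally have "a * (2 / 3 * x) \<le> a * ln (1 + x)"
    using assms by (intro mult_left_mono) auto
  then have "t\<^sup>2 / 3 \<le> a * ln (1 + x)"
    using x(3) by (simp add: algebra_simps)
  then show ?thesis using x by (simp add: powr_def x_def)
qed

lemma cauchy_deviation:
  fixes f :: "'a::euclidean_space \<Rightarrow> real"
  assumes lip: "1-lipschitz_on UNIV f" and a: "0 < \<alpha> - real DIM('a)"
    and t: "0 \<le> t" "t \<le> sqrt (\<alpha> - real DIM('a))"
  shows "emeasure (cauchy_measure \<alpha> :: ('a \<times> 'a) measure)
      {(x, y). sqrt (\<alpha> - real DIM('a)) * \<bar>f x - f y\<bar> \<ge> t} \<le> ennreal (2 * exp (- (t\<^sup>2 / 3)))"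
proof -
  define r where "r = t / sqrt (\<alpha> - real DIM('a))"
  have r: "0 \<le> r" "r\<^sup>2 = t\<^sup>2 / (\<alpha> - real DIM('a))" using a t by (simp_all add: r_def power_divide)
  have t2: "t\<^sup>2 \<le> \<alpha> - real DIM('a)" using power_mono[OF t(2,1), of 2] a by simp
  have f: "f \<in> borel_measurable borel"
    using lipschitz_on_continuous_on[OF lip] by (rule borel_measurable_continuous_onI)
  have "{(x, y). r \<le> \<bar>f x - f y\<bar>} = {(x, y). r \<le> f x - f y} \<union> {(x, y). r \<le> - f x - (- f y)}"
    by auto
  then have meas: "{(x, y). r \<le> \<bar>f x - f y\<bar>} \<in> sets borel"
    using sets_borel_difference_ge[OF f, of r] sets_borel_difference_ge[OF borel_measurable_uminus[OF f], of r]
    by (simp only: sets.Un)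
  have "emeasure (cauchy_measure \<alpha> :: ('a \<times> 'a) measure) {(x, y). r \<le> \<bar>f x - f y\<bar>}
      \<le> ennreal (2 * (1 + r\<^sup>2 / 2) powr (- (\<alpha> - real DIM('a \<times> 'a) / 2)))"
    using a r(1) gaussian_deviation[OF lip _ r(1)]
    by (intro cauchy_measure_le_of_gaussian_bound meas) auto
  also have "\<dots> \<le> ennreal (2 * exp (- (t\<^sup>2 / 3)))"
    using one_plus_half_square_powr_le[OF a t2] by (intro ennreal_leI) (simp add: r(2))
  also have "{(x, y). r \<le> \<bar>f x - f y\<bar>} = {(x, y). sqrt (\<alpha> - real DIM('a)) * \<bar>f x - f y\<bar> \<ge> t}"
    using a by (simp add: r_def field_simps)
  finally show ?thesis .
qed

lemma emeasure_cauchy_measure_UNIV_le_1: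
  assumes "real DIM('a) / 2 < \<alpha>"
  shows "emeasure (cauchy_measure \<alpha> :: 'a::euclidean_space measure) UNIV \<le> 1"
proof -
  have "emeasure (cauchy_measure \<alpha> :: 'a measure) UNIV \<le> ennreal (1 * (1 + 0) powr (- (\<alpha> - real DIM('a) / 2)))"
  proof (rule cauchy_measure_le_of_gaussian_bound)
    fix t :: real assume "0 < t"
    then show "(\<integral>\<^sup>+z. ennreal (exp (- t * (norm z)\<^sup>2)) * indicator (UNIV :: 'a set) z \<partial>lborel)
        \<le> ennreal (1 * exp (- t * 0) * (pi / t) powr (real DIM('a) / 2))"
      using nn_integral_gaussian[of t, where 'a='a] by simp
  qed (use assms in auto)
  then show ?thesis by simp
qed

text \<open>
  \<open>(1 + (norm x)\<^sup>2) * (1 + (norm y)\<^sup>2) \<ge> 1 + (norm x)\<^sup>2 + (norm y)\<^sup>2\<close> compares the two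
  densities up to their normalising constants.
\<close>

lemma emeasure_product_cauchy_measure_le:
  fixes A :: "('a::euclidean_space \<times> 'a) set"
  assumes \<alpha>: "real DIM('a) < \<alpha>"
  shows "emeasure ((cauchy_measure \<alpha> :: 'a measure) \<Otimes>\<^sub>M (cauchy_measure \<alpha> :: 'a measure)) A
    \<le> ennreal (cauchy_const (2 * DIM('a)) \<alpha> / (cauchy_const DIM('a) \<alpha>)\<^sup>2)
      * emeasure (cauchy_measure \<alpha> :: ('a \<times> 'a) measure) A"
proof (cases "A \<in> sets borel")
  case False
  then have "A \<notin> sets ((cauchy_measure \<alpha> :: 'a measure) \<Otimes>\<^sub>M (cauchy_measure \<alpha> :: 'a measure))"
    by (simp add: cauchy_measure_def borel_prod[symmetric] cong: sets_pair_measure_cong)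
  then show ?thesis by (simp add: emeasure_notin_sets)
next
  case [measurable]: True
  define c1 where "c1 = cauchy_const DIM('a) \<alpha>"
  define c2 where "c2 = cauchy_const (2 * DIM('a)) \<alpha>"
  have "0 < Gamma \<alpha>" "0 < Gamma (\<alpha> - real DIM('a) / 2)" "0 < Gamma (\<alpha> - real DIM('a))"
    using \<alpha> by (auto intro!: Gamma_real_pos)
  then have c: "0 < c1" "0 < c2" by (simp_all add: c1_def c2_def cauchy_const_def)
  let ?d = "\<lambda>x::'a. ennreal (1 / c1 * (1 + (norm x)\<^sup>2) powr (- \<alpha>))"
  have M: "cauchy_measure \<alpha> = density lborel ?d" by (simp add: cauchy_measure_def c1_def)
  have "emeasure (density lborel ?d) UNIV \<le> 1"
    using emeasure_cauchy_measure_UNIV_le_1[of \<alpha>, where 'a='a] \<alpha> by (simp add: M)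
  then interpret D: finite_measure "density lborel ?d"
    by (intro finite_measureI) (auto simp: top_unique)
  have "emeasure ((cauchy_measure \<alpha> :: 'a measure) \<Otimes>\<^sub>M (cauchy_measure \<alpha> :: 'a measure)) A
      = emeasure (density lborel (\<lambda>(x, y). ?d x * ?d y)) A"
    unfolding M
    using D.sigma_finite_measure_axioms
    by (subst pair_measure_density) (simp_all only: lborel_prod lborel.sigma_finite_measure_axioms, measurable)
  also have "\<dots> = (\<integral>\<^sup>+z. (case z of (x, y) \<Rightarrow> ?d x * ?d y) * indicator A z \<partial>lborel)"
  proof (rule emeasure_density)
    show "(\<lambda>(x, y). ?d x * ?d y) \<in> borel_measurable lborel"
      unfolding lborel_prod[symmetric] by measurable
  qed simp
  also have "\<dots> \<le> (\<integral>\<^sup>+z. ennreal (c2 / c1\<^sup>2) * (ennreal (1 / c2 * (1 + (norm z)\<^sup>2) powr (- \<alpha>)) * indicator A z) \<partial>lborel)"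
  proof (rule nn_integral_mono, clarify)
    fix x y :: 'a
    have "(1 + (norm x)\<^sup>2) powr (- \<alpha>) * (1 + (norm y)\<^sup>2) powr (- \<alpha>) \<le> (1 + (norm (x, y))\<^sup>2) powr (- \<alpha>)"
    proof -
      have "((1 + (norm x)\<^sup>2) * (1 + (norm y)\<^sup>2)) powr (- \<alpha>) \<le> (1 + (norm (x, y))\<^sup>2) powr (- \<alpha>)"
        using \<alpha> by (intro powr_mono2') (auto simp: norm_Pair algebra_simps intro: add_pos_nonneg)
      then show ?thesis by (simp add: powr_mult)
    qed
    then have "(1 / c1 * (1 + (norm x)\<^sup>2) powr (- \<alpha>)) * (1 / c1 * (1 + (norm y)\<^sup>2) powr (- \<alpha>))
        \<le> c2 / c1\<^sup>2 * (1 / c2 * (1 + (norm (x, y))\<^sup>2) powr (- \<alpha>))"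
      using c by (simp add: power2_eq_square divide_simps)
    then show "(?d x * ?d y) * indicator A (x, y)
        \<le> ennreal (c2 / c1\<^sup>2) * (ennreal (1 / c2 * (1 + (norm (x, y))\<^sup>2) powr (- \<alpha>)) * indicator A (x, y))"
      using c by (auto simp: indicator_def ennreal_leI simp flip: ennreal_mult)
  qed
  also have "\<dots> = ennreal (c2 / c1\<^sup>2) * (\<integral>\<^sup>+z. ennreal (1 / c2 * (1 + (norm z)\<^sup>2) powr (- \<alpha>)) * indicator A z \<partial>lborel)"
    by (rule nn_integral_cmult) measurable
  also have "(\<integral>\<^sup>+z. ennreal (1 / c2 * (1 + (norm z)\<^sup>2) powr (- \<alpha>)) * indicator A z \<partial>lborel)
      = emeasure (cauchy_measure \<alpha> :: ('a \<times> 'a) measure) A"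
    unfolding cauchy_measure_def c2_def by (subst emeasure_density) (auto simp: mult_2)
  finally show ?thesis by (simp add: c1_def c2_def)
qed

theorem corollary2p5:
  fixes f :: "real^'n \<Rightarrow> real" and \<alpha> :: real
  assumes "\<alpha> \<ge> real CARD('n) + 3 / 2"
    and "lip_seminorm f \<le> 1"
  shows "(\<forall>t. 0 \<le> t \<and> t \<le> sqrt (\<alpha> - real CARD('n)) \<longrightarrow>
            emeasure (cauchy_measure \<alpha> :: ((real^'n) \<times> (real^'n)) measure)
              {(x, y). sqrt (\<alpha> - real CARD('n)) * \<bar>f x - f y\<bar> \<ge> t}
            \<le> ennreal (2 * exp (- (t\<^sup>2 / 12))))
       \<and> (\<alpha> \<ge> (real CARD('n))\<^sup>2 \<longrightarrow>
          (\<forall>t. 0 \<le> t \<and> t \<le> sqrt (\<alpha> - real CARD('n)) \<longrightarrow>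
            emeasure ((cauchy_measure \<alpha> :: (real^'n) measure) \<Otimes>\<^sub>M (cauchy_measure \<alpha> :: (real^'n) measure))
              {(x, y). sqrt (\<alpha> - real CARD('n)) * \<bar>f x - f y\<bar> \<ge> t}
            \<le> ennreal (4 * exp (- (t\<^sup>2 / 12)))))"
proof (intro conjI impI allI; elim conjE)
  have lip: "1-lipschitz_on UNIV f" using assms(2) by (simp only: lip_seminorm_le_1_iff)
  fix t :: real assume t: "0 \<le> t" "t \<le> sqrt (\<alpha> - real CARD('n))"
  let ?A = "{(x, y). sqrt (\<alpha> - real CARD('n)) * \<bar>f x - f y\<bar> \<ge> t}"
  have joint: "emeasure (cauchy_measure \<alpha>) ?A \<le> ennreal (2 * exp (- (t\<^sup>2 / 3)))"
    using cauchy_deviation[OF lip, of \<alpha> t] assms(1) t by simp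
  also have "\<dots> \<le> ennreal (2 * exp (- (t\<^sup>2 / 12)))"
    by (intro ennreal_leI) simp
  finally show "emeasure (cauchy_measure \<alpha>) ?A \<le> ennreal (2 * exp (- (t\<^sup>2 / 12)))" .
  let ?M = "cauchy_measure \<alpha> :: (real^'n) measure"
  assume \<alpha>: "\<alpha> \<ge> (real CARD('n))\<^sup>2"
  show "emeasure (?M \<Otimes>\<^sub>M ?M) ?A \<le> ennreal (4 * exp (- (t\<^sup>2 / 12)))"
  \<comment> \<open>For \<open>t\<^sup>2 \<le> 12\<close> the bound is at least \<open>4 / exp 1 > 1\<close>; beyond that the better exponent
      \<open>t\<^sup>2 / 3\<close> absorbs the factor \<open>exp 3\<close>, because \<open>3 - t\<^sup>2 / 3 \<le> - t\<^sup>2 / 12\<close>.\<close>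
  proof (cases "t\<^sup>2 \<le> 12")
    case True
    have mass: "emeasure ?M UNIV \<le> 1"
      using assms(1) by (intro emeasure_cauchy_measure_UNIV_le_1) simp
    interpret finite_measure ?M
      using mass by (intro finite_measureI) (auto simp: cauchy_measure_def top_unique)
    have "emeasure (?M \<Otimes>\<^sub>M ?M) ?A \<le> emeasure (?M \<Otimes>\<^sub>M ?M) (space (?M \<Otimes>\<^sub>M ?M))"
      by (rule emeasure_space)
    also have "\<dots> = emeasure ?M UNIV * emeasure ?M UNIV"
      unfolding space_pair_measure by (subst emeasure_pair_measure_Times) (auto simp: cauchy_measure_def)
    also have "\<dots> \<le> 1 * 1" using mass by (intro mult_mono) auto
    also have "\<dots> \<le> ennreal (4 * exp (- (t\<^sup>2 / 12)))"
    proof -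
      have "exp (1 :: real) \<le> 4" using exp_le by simp
      then have "1 \<le> 4 * exp (- 1 :: real)" by (simp add: exp_minus field_simps)
      also have "\<dots> \<le> 4 * exp (- (t\<^sup>2 / 12))" using True by simp
      finally show ?thesis by simp
    qed
    finally show ?thesis .
  next
    case False
    have "emeasure (?M \<Otimes>\<^sub>M ?M) ?A
        \<le> ennreal (cauchy_const (2 * CARD('n)) \<alpha> / (cauchy_const CARD('n) \<alpha>)\<^sup>2) * emeasure (cauchy_measure \<alpha>) ?A"
      using emeasure_product_cauchy_measure_le[of \<alpha> ?A] assms(1) by simp
    also have "\<dots> \<le> ennreal (exp 3) * ennreal (2 * exp (- (t\<^sup>2 / 3)))"
      using assms(1) \<alpha> by (intro mult_mono joint ennreal_leI cauchy_const_ratio_le) auto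
    also have "\<dots> = ennreal (2 * exp (3 - t\<^sup>2 / 3))"
    proof -
      have "exp 3 * (2 * exp (- (t\<^sup>2 / 3))) = 2 * exp (3 - t\<^sup>2 / 3)"
        by (simp only: exp_diff exp_minus divide_inverse mult_ac)
      then show ?thesis by (simp only: ennreal_mult[symmetric] exp_ge_zero mult_nonneg_nonneg zero_le_numeral)
    qed
    also have "\<dots> \<le> ennreal (4 * exp (- (t\<^sup>2 / 12)))"
      using False by (intro ennreal_leI mult_mono) auto
    finally show ?thesis .
  qed
qed

end
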